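(* For every integer $n\geq 1$, all real numbers $a,b>0$ and all $x$, \[ \sum_{l=0}^{n}\binom{n}{l}\frac{(a)_{l}(b)_{n-l}}{(a+b)_{n}}E_{l}(x)E_{n-l}(x) = \frac{4}{n+1}B_{n+1}(x) -\frac{2}{n+1}\sum_{l=0}^{n+1}\binom{n+1}{l} \frac{(a)_{l}+(b)_{l}}{(a+b)_l}E_l(0)B_{n+1-l}(x). \]
   Context: The Euler polynomials $E_n(x)$ are defined by $\frac{2e^{xz}}{e^z+1}=\sum_{n\ge0}E_n(x)\frac{z^n}{n!}$. The Bernoulli polynomials $B_n(x)$ are defined by $\frac{ze^{xz}}{e^z-1}=\sum_{n\ge0}B_n(x)\frac{z^n}{n!}$. The Pochhammer symbol is $(z)_0=1$, $(z)_m=z(z+1)\cdots(z+m-1)$ for $m\ge1$. *)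

theory Defs
  imports Complex_Main "HOL-Computational_Algebra.Formal_Power_Series"
begin

text \<open>The values \<open>E\<^sub>n(x)\<close> and \<open>B\<^sub>n(x)\<close> are read off from the generating functions, taken as
  formal power series in \<open>z\<close>. In \<open>bernpoly\<close> the denominator has zero constant term; \<open>/\<close> on
  power series over a field cancels the common factor \<open>z\<close>, so the quotient is the intended one
  (see \<open>bernpoly_gf\<close>).\<close>

definition eulerpoly :: "nat \<Rightarrow> 'a::field_char_0 \<Rightarrow> 'a" where
  "eulerpoly n x = fact n * fps_nth (2 * fps_exp x / (fps_exp 1 + 1)) n"

definition bernpoly :: "nat \<Rightarrow> 'a::field_char_0 \<Rightarrow> 'a" where
  "bernpoly n x = fact n * fps_nth (fps_X * fps_exp x / (fps_exp 1 - 1)) n"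

lemma eulerpoly_gf:
  "Abs_fps (\<lambda>n. eulerpoly n x / fact n) * (fps_exp 1 + 1) = 2 * fps_exp x"
proof -
  have "Abs_fps (\<lambda>n. eulerpoly n x / fact n) = 2 * fps_exp x / (fps_exp 1 + 1)"
    by (simp add: fps_eq_iff eulerpoly_def)
  moreover have "fps_nth (fps_exp 1 + 1 :: 'a fps) 0 \<noteq> 0"
    by simp
  ultimately show ?thesis
    by (simp add: fps_divide_unit mult.assoc inverse_mult_eq_1)
qed

lemma bernpoly_gf:
  "Abs_fps (\<lambda>n. bernpoly n x / fact n) * (fps_exp 1 - 1) = fps_X * fps_exp x"
proof -
  have *: "Abs_fps (\<lambda>n. bernpoly n x / fact n) = fps_X * fps_exp x / (fps_exp 1 - 1)"
    by (simp add: fps_eq_iff bernpoly_def)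
  have "subdegree (fps_exp 1 - 1 :: 'a fps) = 1"
    by (rule subdegreeI) auto
  moreover have "fps_exp 1 - 1 \<noteq> (0 :: 'a fps)"
    using \<open>subdegree (fps_exp 1 - 1 :: 'a fps) = 1\<close> by auto
  ultimately have "(fps_exp 1 - 1 :: 'a fps) dvd fps_X * fps_exp x"
    by (subst fps_dvd_iff) auto
  then show ?thesis
    unfolding * by (rule dvd_div_mult_self)
qed

end

theory Submission
  imports Defs "HOL-Computational_Algebra.Polynomial"
begin

text \<open>
  With \<open>u = exp (t z)\<close> and \<open>v = exp ((1 - t) z)\<close> one has \<open>u v = exp z\<close> and
  \<open>(u v - 1) / ((u + 1) (v + 1)) = 1 - 1 / (u + 1) - 1 / (v + 1)\<close>. Multiplying by
  \<open>4 z exp (x z) / (exp z - 1)\<close> and comparing coefficients of \<open>z\<close> gives a convolution identity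
  that is polynomial in \<open>t\<close>, so a linear functional of \<open>t\<close> may be applied to it. If
  \<open>w i j = w (i + 1) j + w i (j + 1)\<close>, then some functional sends every \<open>t ^ i * (1 - t) ^ j\<close> to
  \<open>w i j\<close>. The theorem is the case \<open>w i j = (a)\<^sub>i (b)\<^sub>j / (a + b)\<^bsub>i + j\<^esub>\<close>, in which the functional is
  the expectation under the Beta distribution with parameters \<open>a\<close> and \<open>b\<close>.
\<close>

definition egf :: "(nat \<Rightarrow> 'a::field_char_0) \<Rightarrow> 'a fps" where
  "egf f = Abs_fps (\<lambda>n. f n / fact n)"

lemma egf_nth [simp]: "fps_nth (egf f) n = f n / fact n"
  by (simp add: egf_def)

lemma egf_add: "egf f + egf g = egf (\<lambda>n. f n + g n)"
  by (simp add: fps_eq_iff add_divide_distrib)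

lemma egf_mult: "egf f * egf g = egf (\<lambda>n. \<Sum>k\<le>n. of_nat (n choose k) * f k * g (n - k))"
proof (rule fps_ext)
  fix n
  have "f k / fact k * (g (n - k) / fact (n - k)) = of_nat (n choose k) * f k * g (n - k) / fact n"
    if "k \<le> n" for k
    using that by (simp add: binomial_fact)
  then show "fps_nth (egf f * egf g) n
      = fps_nth (egf (\<lambda>n. \<Sum>k\<le>n. of_nat (n choose k) * f k * g (n - k))) n"
    by (simp add: fps_mult_nth atLeast0AtMost sum_divide_distrib)
qed

lemma egf_compose_linear: "egf f oo (fps_const t * fps_X) = egf (\<lambda>n. t ^ n * f n)"
  by (simp add: fps_compose_linear fps_eq_iff)

definition eulerpoly_egf :: "'a::field_char_0 \<Rightarrow> 'a \<Rightarrow> 'a fps" where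
  "eulerpoly_egf t x = egf (\<lambda>n. t ^ n * eulerpoly n x)"

lemma eulerpoly_egf_mult_fps_exp_plus_1: "eulerpoly_egf t x * (fps_exp t + 1) = 2 * fps_exp (t * x)"
proof -
  have "(egf (\<lambda>n. eulerpoly n x) * (fps_exp 1 + 1)) oo (fps_const t * fps_X)
      = (2 * fps_exp x) oo (fps_const t * fps_X)"
    by (simp only: egf_def eulerpoly_gf)
  then show ?thesis
    by (simp add: eulerpoly_egf_def fps_compose_mult_distrib fps_compose_add_distrib
        egf_compose_linear)
qed

lemma eulerpoly_egf_shift: "eulerpoly_egf t x = fps_exp (t * x) * eulerpoly_egf t 0"
proof -
  have "eulerpoly_egf t x * (fps_exp t + 1)
      = fps_exp (t * x) * eulerpoly_egf t 0 * (fps_exp t + 1)"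
    by (simp add: eulerpoly_egf_mult_fps_exp_plus_1 mult.assoc)
  moreover have "fps_exp t + 1 \<noteq> 0"
    by (rule fps_nonzeroI[of _ 0]) simp
  ultimately show ?thesis
    by simp
qed

lemma two_div_plus_one_mult:
  fixes u v e f :: "'a::comm_ring_1"
  assumes "e * (u + 1) = 2" and "f * (v + 1) = 2"
  shows "e * f * (u * v - 1) = 4 - 2 * (e + f)"
proof -
  have "e * f * (u * v - 1)
      = (e * (u + 1)) * (f * (v + 1)) - (e * (u + 1)) * f - e * (f * (v + 1))"
    by (simp add: algebra_simps)
  also have "\<dots> = 4 - 2 * (e + f)"
    by (simp only: assms) (simp add: algebra_simps)
  finally show ?thesis .
qed

lemma fps_exp_mult_of_add_eq_1:
  fixes s t y :: "'a::field_char_0"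
  assumes "t + s = 1"
  shows "fps_exp (t * y) * fps_exp (s * y) = fps_exp y"
  by (simp add: assms flip: fps_exp_add_mult distrib_right)

lemma eulerpoly_egf_mult:
  fixes s t x :: "'a::field_char_0"
  assumes "t + s = 1"
  shows "eulerpoly_egf t x * eulerpoly_egf s x * (fps_exp 1 - 1)
    = fps_exp x * (4 - 2 * (eulerpoly_egf t 0 + eulerpoly_egf s 0))"
proof -
  have "eulerpoly_egf t x * eulerpoly_egf s x
      = (fps_exp (t * x) * fps_exp (s * x)) * (eulerpoly_egf t 0 * eulerpoly_egf s 0)"
    unfolding eulerpoly_egf_shift[of _ x] by (simp only: mult_ac)
  moreover have "eulerpoly_egf t 0 * eulerpoly_egf s 0 * (fps_exp t * fps_exp s - 1)
      = 4 - 2 * (eulerpoly_egf t 0 + eulerpoly_egf s 0)"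
    by (rule two_div_plus_one_mult) (simp_all add: eulerpoly_egf_mult_fps_exp_plus_1)
  ultimately show ?thesis
    using fps_exp_mult_of_add_eq_1[OF assms, of 1] fps_exp_mult_of_add_eq_1[OF assms, of x]
    by (simp add: mult.assoc)
qed

lemma fps_X_mult_eulerpoly_egf_mult:
  fixes s t x :: "'a::field_char_0"
  assumes "t + s = 1"
  shows "fps_X * (eulerpoly_egf t x * eulerpoly_egf s x)
    = (4 - 2 * (eulerpoly_egf t 0 + eulerpoly_egf s 0)) * egf (\<lambda>n. bernpoly n x)"
    (is "_ * ?E = ?C * ?B")
proof -
  have bernpoly_egf: "?B * (fps_exp 1 - 1) = fps_X * fps_exp x"
    unfolding egf_def by (rule bernpoly_gf)
  have "fps_X * ?E * (fps_exp 1 - 1) = fps_X * (fps_exp x * ?C)"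
    by (simp only: eulerpoly_egf_mult[OF assms] mult.assoc[of fps_X])
  also have "\<dots> = ?C * (fps_X * fps_exp x)"
    by (simp only: mult_ac)
  also have "\<dots> = ?C * ?B * (fps_exp 1 - 1)"
    by (simp only: bernpoly_egf mult.assoc)
  finally have "fps_X * ?E * (fps_exp 1 - 1) = ?C * ?B * (fps_exp 1 - 1)" .
  moreover have "fps_exp 1 - 1 \<noteq> (0 :: 'a fps)"
    by (rule fps_nonzeroI[of _ 1]) simp
  ultimately show ?thesis
    by simp
qed

lemma eulerpoly_convolution:
  fixes s t x :: "'a::field_char_0"
  assumes "t + s = 1"
  shows "(\<Sum>l\<le>n. of_nat (n choose l)
        * (t ^ l * s ^ (n - l)) * eulerpoly l x * eulerpoly (n - l) x)
    = 4 / of_nat (n + 1) * bernpoly (n + 1) x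
      - 2 / of_nat (n + 1) * (\<Sum>l\<le>n + 1. of_nat ((n + 1) choose l)
        * (t ^ l + s ^ l) * eulerpoly l 0 * bernpoly (n + 1 - l) x)"
    (is "?L = 4 / _ * ?B - 2 / _ * ?R")
proof -
  let ?E = "eulerpoly_egf t x * eulerpoly_egf s x"
  let ?F = "(eulerpoly_egf t 0 + eulerpoly_egf s 0) * egf (\<lambda>n. bernpoly n x)"
  have F_nth: "fps_nth ?F (n + 1) = ?R / fact (n + 1)"
    by (simp only: eulerpoly_egf_def egf_add egf_mult egf_nth mult.assoc flip: distrib_right)
  have "?L = fact n * fps_nth ?E n"
    unfolding eulerpoly_egf_def egf_mult by (simp add: mult_ac)
  also have "fps_nth ?E n = fps_nth (fps_X * ?E) (n + 1)"
    by (simp only: fps_X_mult_nth) simp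
  also have "fps_nth (fps_X * ?E) (n + 1) = fps_nth (4 * egf (\<lambda>n. bernpoly n x) - 2 * ?F) (n + 1)"
    by (simp only: fps_X_mult_eulerpoly_egf_mult[OF assms] left_diff_distrib mult.assoc)
  also have "fps_nth (4 * egf (\<lambda>n. bernpoly n x) - 2 * ?F) (n + 1)
      = 4 * (?B / fact (n + 1)) - 2 * (?R / fact (n + 1))"
    unfolding F_nth[symmetric] by (simp add: numeral_fps_const)
  finally have "?L = fact n * (4 * (?B / fact (n + 1)) - 2 * (?R / fact (n + 1)))" .
  moreover have "fact (n + 1) = (of_nat (n + 1) * fact n :: 'a)"
    by simp
  ultimately show ?thesis
    by (simp add: right_diff_distrib del: of_nat_add sum.atMost_Suc)
qed

definition moment_functional :: "(nat \<Rightarrow> 'a::comm_ring_1) \<Rightarrow> 'a poly \<Rightarrow> 'a" where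
  "moment_functional m p = (\<Sum>k\<le>degree p. coeff p k * m k)"

lemma moment_functional_altdef:
  assumes "degree p \<le> n"
  shows "moment_functional m p = (\<Sum>k\<le>n. coeff p k * m k)"
  unfolding moment_functional_def using assms
  by (intro sum.mono_neutral_left) (auto simp: coeff_eq_0)

lemma moment_functional_monom [simp]: "moment_functional m (monom c k) = c * m k"
  by (simp add: moment_functional_altdef[OF degree_monom_le] if_distrib[of "\<lambda>y. y * _"]
      cong: if_cong)

interpretation moment_functional: module_hom smult "(*)" "moment_functional m"
  for m :: "nat \<Rightarrow> 'a::comm_ring_1"
proof
  fix p q :: "'a poly" and c :: 'a
  let ?n = "max (degree p) (degree q)"
  have "degree (p + q) \<le> ?n"
    by (rule degree_add_le_max)
  then show "moment_functional m (p + q) = moment_functional m p + moment_functional m q"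
    by (simp add: moment_functional_altdef[of _ ?n] distrib_right sum.distrib)
  show "moment_functional m (smult c p) = c * moment_functional m p"
    by (subst moment_functional_altdef[OF degree_smult_le])
      (simp add: moment_functional_def sum_distrib_left mult.assoc)
qed (simp_all add: smult_add_right smult_add_left algebra_simps)

definition bernstein_monom :: "nat \<Rightarrow> nat \<Rightarrow> 'a::comm_ring_1 poly" where
  "bernstein_monom i j = monom 1 i * [:1, -1:] ^ j"

lemma poly_bernstein_monom: "poly (bernstein_monom i j) t = t ^ i * (1 - t) ^ j"
  by (simp add: bernstein_monom_def poly_monom)

lemma bernstein_monom_split:
  "bernstein_monom i j = bernstein_monom (Suc i) j + bernstein_monom i (Suc j)"
  by (simp add: bernstein_monom_def monom_Suc algebra_simps)

lemma moment_functional_bernstein_monom: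
  fixes w :: "nat \<Rightarrow> nat \<Rightarrow> 'a::comm_ring_1"
  assumes w_split: "\<And>i j. w i j = w (Suc i) j + w i (Suc j)"
  shows "moment_functional (\<lambda>k. w k 0) (bernstein_monom i j) = w i j"
proof (induction j arbitrary: i)
  case 0
  show ?case
    by (simp add: bernstein_monom_def)
next
  case (Suc j)
  have "w i j = w (Suc i) j + moment_functional (\<lambda>k. w k 0) (bernstein_monom i (Suc j))"
    using bernstein_monom_split[of i j] by (metis moment_functional.add Suc.IH)
  then show ?case
    using w_split[of i j] by simp
qed

lemma eulerpoly_convolution_weighted:
  fixes w :: "nat \<Rightarrow> nat \<Rightarrow> 'a::field_char_0"
  assumes w_split: "\<And>i j. w i j = w (Suc i) j + w i (Suc j)"
  shows "(\<Sum>l\<le>n. of_nat (n choose l) * w l (n - l) * eulerpoly l x * eulerpoly (n - l) x)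
    = 4 / of_nat (n + 1) * w 0 0 * bernpoly (n + 1) x
      - 2 / of_nat (n + 1) * (\<Sum>l\<le>n + 1. of_nat ((n + 1) choose l)
        * (w l 0 + w 0 l) * eulerpoly l 0 * bernpoly (n + 1 - l) x)"
proof -
  define L where "L = moment_functional (\<lambda>k. w k 0)"
  interpret L: module_hom smult "(*)" L
    unfolding L_def by (rule moment_functional.module_hom_axioms)
  have L_bernstein_monom: "L (bernstein_monom i j) = w i j" for i j
    unfolding L_def by (rule moment_functional_bernstein_monom[of w, OF w_split])
  define left_coeff
    where "left_coeff l = of_nat (n choose l) * eulerpoly l x * eulerpoly (n - l) x" for l
  define right_coeff
    where "right_coeff l = of_nat ((n + 1) choose l) * eulerpoly l 0 * bernpoly (n + 1 - l) x" for l
  define p where "p = (\<Sum>l\<le>n. smult (left_coeff l) (bernstein_monom l (n - l)))"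
  define q where "q = smult (4 / of_nat (n + 1) * bernpoly (n + 1) x) (bernstein_monom 0 0)
      - smult (2 / of_nat (n + 1)) (\<Sum>l\<le>n + 1.
          smult (right_coeff l) (bernstein_monom l 0 + bernstein_monom 0 l))"
  have "poly p t = poly q t" for t
  proof -
    have "t + (1 - t) = 1"
      by simp
    from eulerpoly_convolution[OF this, of n x] show ?thesis
      by (simp only: p_def q_def left_coeff_def right_coeff_def poly_diff poly_add poly_smult
          poly_sum poly_bernstein_monom power_0 mult_1_left mult_1_right mult_ac)
  qed
  then have "p = q"
    by (intro poly_eq_poly_eq_iff[THEN iffD1] ext)
  then have "L p = L q"
    by (rule arg_cong)
  then show ?thesis
    by (simp only: p_def q_def L.add L.diff L.scale L.sum L_bernstein_monom
        left_coeff_def right_coeff_def mult_ac)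
qed

definition beta_weight :: "'a::field \<Rightarrow> 'a \<Rightarrow> nat \<Rightarrow> nat \<Rightarrow> 'a" where
  "beta_weight a b i j = pochhammer a i * pochhammer b j / pochhammer (a + b) (i + j)"

lemma beta_weight_split:
  assumes "pochhammer (a + b) (Suc (i + j)) \<noteq> 0"
  shows "beta_weight a b i j = beta_weight a b (Suc i) j + beta_weight a b i (Suc j)"
proof -
  define q where "q = a + b + of_nat (i + j)"
  have "q \<noteq> 0"
    using assms by (simp add: pochhammer_Suc q_def)
  have "beta_weight a b (Suc i) j = beta_weight a b i j * ((a + of_nat i) / q)"
    by (simp add: beta_weight_def pochhammer_Suc q_def)
  moreover have "beta_weight a b i (Suc j) = beta_weight a b i j * ((b + of_nat j) / q)"
    by (simp add: beta_weight_def pochhammer_Suc q_def)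
  moreover have "(a + of_nat i) / q + (b + of_nat j) / q = 1"
    using \<open>q \<noteq> 0\<close> by (simp add: q_def flip: add_divide_distrib)
  ultimately show ?thesis
    by (simp only: mult_1_right flip: distrib_left)
qed

theorem theorem3:
  fixes n :: nat and a b :: real and x :: complex
  assumes "n \<ge> 1" and "a > 0" and "b > 0"
  shows "(\<Sum>l=0..n. of_nat (n choose l)
            * of_real (pochhammer a l * pochhammer b (n - l) / pochhammer (a + b) n)
            * eulerpoly l x * eulerpoly (n - l) x)
       = 4 / of_nat (n + 1) * bernpoly (n + 1) x
         - 2 / of_nat (n + 1) * (\<Sum>l=0..n+1. of_nat ((n + 1) choose l)
            * of_real ((pochhammer a l + pochhammer b l) / pochhammer (a + b) l)
            * eulerpoly l 0 * bernpoly (n + 1 - l) x)"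
proof -
  define w where "w = (\<lambda>i j. complex_of_real (beta_weight a b i j))"
  have "pochhammer (a + b) k \<noteq> 0" for k
    using pochhammer_pos[of "a + b" k] assms(2,3) by simp
  then have "w i j = w (Suc i) j + w i (Suc j)" for i j
    by (simp add: w_def beta_weight_split[of a b i j])
  note eulerpoly_convolution_weighted[of w n x, OF this]
  moreover have "w l (n - l)
      = of_real (pochhammer a l * pochhammer b (n - l) / pochhammer (a + b) n)" if "l \<le> n" for l
    using that by (simp add: w_def beta_weight_def)
  moreover have "w l 0 + w 0 l
      = of_real ((pochhammer a l + pochhammer b l) / pochhammer (a + b) l)" for l
    by (simp add: w_def beta_weight_def add_divide_distrib)
  moreover have "w 0 0 = 1"
    by (simp add: w_def beta_weight_def)
  ultimately show ?thesis
    by (simp add: atLeast0AtMost del: sum.atMost_Suc)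
qed

end
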